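(* For a prime power $q$, let $H$ be the complete $(q+1)$-partite graph with $q$ vertices in every part. Let $G$ be a graph obtained from $H$ by removing at most $q-1$ of its vertices. Then, for every field $\mathbb{F}$, $\mathrm{ch\text{-}s}(G,\mathbb{F}) > q$.
   Context: In the complete $(q+1)$-partite graph, two vertices are adjacent if and only if they belong to distinct parts. Removing a vertex also removes all edges incident with it. Inner product: on $\mathbb{C}^t$, $\langle x,y\rangle=\sum_i x_i\overline{y_i}$; on $\mathbb{F}^t$ for every other field $\mathbb{F}$ (in particular $\mathbb{R}$ and finite fields), $\langle x,y\rangle=\sum_i x_iy_i$. A finite simple graph $G=(V,E)$ is $k$-subspace choosable over $\mathbb{F}$ if for every integer $t$ and every assignment of subspaces $W_v\subseteq\mathbb{F}^t$ with $\dim(W_v)=k$ to the vertices $v\in V$, there exists a choice of a nonzero vector $x_v\in W_v$ for each $v\in V$ such that $\langle x_v,x_{v'}\rangle=0$ whenever $v$ and $v'$ are adjacent in $G$. The subspace choice number $\mathrm{ch\text{-}s}(G,\mathbb{F})$ is the smallest positive integer $k$ for which $G$ is $k$-subspace choosable over $\mathbb{F}$. *)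

theory Defs
  imports
    "HOL-Number_Theory.Prime_Powers"
    "HOL-Library.Disjoint_Sets"
    "Graph_Theory.Pair_Digraph"
    "Jordan_Normal_Form.VS_Connect"
begin

text \<open>A finite simple graph is a \<^locale>\<open>pair_graph\<close>: a finite vertex set with a symmetric,
  irreflexive set of arcs, each undirected edge being present as its two arcs.\<close>

definition complete_multipartite :: "'v set set \<Rightarrow> 'v pair_pre_digraph" where
  "complete_multipartite P =
     \<lparr>pverts = \<Union>P, parcs = {(u, v). \<exists>A\<in>P. \<exists>B\<in>P. A \<noteq> B \<and> u \<in> A \<and> v \<in> B}\<rparr>"

definition remove_verts :: "'v pair_pre_digraph \<Rightarrow> 'v set \<Rightarrow> 'v pair_pre_digraph" where
  "remove_verts G R =
     \<lparr>pverts = pverts G - R, parcs = {(u, v) \<in> parcs G. u \<notin> R \<and> v \<notin> R}\<rparr>"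

definition is_subspace_of_dim :: "nat \<Rightarrow> 'f::field vec set \<Rightarrow> nat \<Rightarrow> bool" where
  "is_subspace_of_dim t W k \<longleftrightarrow>
     VectorSpace.subspace class_ring W (module_vec TYPE('f) t) \<and>
     vectorspace.dim class_ring ((module_vec TYPE('f) t)\<lparr>carrier := W\<rparr>) = k"

text \<open>The argument \<open>ip\<close> below is the inner product, on the spaces \<open>F\<^sup>t\<close> for all \<open>t\<close> at once: it is to be
  instantiated by the bilinear \<^const>\<open>scalar_prod\<close> for a general field and by the Hermitian
  \<^abbrev>\<open>cscalar_prod\<close>, conjugate-linear in its second argument, for the complex numbers.\<close>

definition subspace_choosable ::
  "('f::field vec \<Rightarrow> 'f vec \<Rightarrow> 'f) \<Rightarrow> 'v pair_pre_digraph \<Rightarrow> nat \<Rightarrow> bool" where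
  "subspace_choosable ip G k \<longleftrightarrow>
     (\<forall>t W. (\<forall>v\<in>pverts G. is_subspace_of_dim t (W v) k) \<longrightarrow>
        (\<exists>x. (\<forall>v\<in>pverts G. x v \<in> W v \<and> x v \<noteq> 0\<^sub>v t) \<and>
             (\<forall>(u, v)\<in>parcs G. ip (x u) (x v) = 0)))"

definition ch_s :: "('f::field vec \<Rightarrow> 'f vec \<Rightarrow> 'f) \<Rightarrow> 'v pair_pre_digraph \<Rightarrow> nat" where
  "ch_s ip G = (LEAST k. 0 < k \<and> subspace_choosable ip G k)"

lemma pair_graph_complete_multipartite:
  assumes "finite P" "\<forall>A\<in>P. finite A" "disjoint P"
  shows "pair_graph (complete_multipartite P)"
proof -
  have "parcs (complete_multipartite P) \<subseteq> \<Union>P \<times> \<Union>P"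
    by (auto simp: complete_multipartite_def)
  moreover have fin: "finite (\<Union>P)" using assms by auto
  ultimately have "finite (parcs (complete_multipartite P))"
    by (meson finite_SigmaI finite_subset)
  moreover have "sym (parcs (complete_multipartite P))"
    by (auto simp: complete_multipartite_def sym_def)
  ultimately show ?thesis
    using assms(3) fin
    by unfold_locales
      (auto simp: complete_multipartite_def symmetric_def disjoint_def, blast+)
qed

lemma pair_graph_remove_verts:
  assumes "pair_graph G"
  shows "pair_graph (remove_verts G R)"
proof -
  interpret pair_graph G by fact
  have "finite (parcs (remove_verts G R))"
    by (rule finite_subset[OF _ pair_finite_arcs]) (auto simp: remove_verts_def)
  moreover have "sym (parcs (remove_verts G R))"
    using arcs_symmetric by (auto simp: remove_verts_def sym_def)
  ultimately show ?thesis
    using pair_finite_verts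
    by unfold_locales
      (auto simp: remove_verts_def symmetric_def dest: in_arcsD1 in_arcsD2 no_loops)
qed

end

theory Submission
  imports
    Defs
    "HOL-Computational_Algebra.Group_Closure"
    "Jordan_Normal_Form.Char_Poly"
begin

text \<open>The subspaces come from the lines of an affine plane of order \<open>q\<close>. Such a plane has \<open>q\<^sup>2\<close> points and \<open>q (q + 1)\<close>
lines, in \<open>q + 1\<close> classes of \<open>q\<close> parallel lines; lines of different classes meet in a single point. Let
the parts of the graph be the classes, its vertices the lines, and let the subspace of a vertex consist
of the vectors in dimension \<open>q\<^sup>2\<close> supported on its line. Each subspace has dimension \<open>q\<close>. If nonzero
vectors are chosen with adjacent ones orthogonal, give every vertex a point of its line where its vector
is nonzero. Two lines through a point belong to different classes and share nothing else, so if both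
were given this point, the inner product of their vectors would have exactly one nonzero term.
Therefore the points are distinct and there are at most \<open>q\<^sup>2\<close> vertices; but at least \<open>q\<^sup>2 + 1\<close> remain
after the removal. Shrinking the lines excludes dimensions below \<open>q\<close> in the same way. This is
\<open>affine_plane_lines\<close> combined with \<open>not_subspace_choosable_of_points\<close>. The inner product
enters as a sum of one term per coordinate, which vanishes just when one of the two entries does; this
is why the argument works over every field and in the Hermitian case. The choice number is well
defined because a greedy choice succeeds in large dimension (\<open>subspace_choosable_Suc_card\<close>).

The coordinates of the plane are a model of the field with \<open>q\<close> elements inside the complex numbers
(\<open>affine_plane_coordinates\<close>): the \<open>q\<close> roots of \<open>X\<^sup>q - X\<close> span a ring, and modulo a prime ideal above the
prime divisor of \<open>q\<close> they form a complete system of residues. A prime ideal above that prime exists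
because the ring is a finitely generated lattice and thus consists of algebraic integers
(\<open>algebraic_int_of_stable_lattice\<close>).\<close>

section \<open>Prime ideals of subrings\<close>

text \<open>The number ring needed below is a subset of the complex numbers and not a type of its own; rings and
ideals are therefore plain sets closed under the operations of the ambient type.\<close>
locale unital_subring =
  fixes A :: "'a::comm_ring_1 set"
  assumes one: "1 \<in> A"
    and diff: "\<And>x y. x \<in> A \<Longrightarrow> y \<in> A \<Longrightarrow> x - y \<in> A"
    and mult: "\<And>x y. x \<in> A \<Longrightarrow> y \<in> A \<Longrightarrow> x * y \<in> A"
begin

lemma zero: "0 \<in> A"
  using diff[OF one one] by simp

lemma add: "x \<in> A \<Longrightarrow> y \<in> A \<Longrightarrow> x + y \<in> A"
  using diff[of x "0 - y"] diff[OF zero] by simp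

lemma nat: "of_nat n \<in> A"
  by (induction n) (auto intro: zero add one)

lemma pow: "x \<in> A \<Longrightarrow> x ^ n \<in> A"
  by (induction n) (auto intro: one mult)

lemma sum: "(\<And>i. i \<in> I \<Longrightarrow> f i \<in> A) \<Longrightarrow> (\<Sum>i\<in>I. f i) \<in> A"
  by (induction I rule: infinite_finite_induct) (auto intro: zero add)

lemma prod: "(\<And>i. i \<in> I \<Longrightarrow> f i \<in> A) \<Longrightarrow> (\<Prod>i\<in>I. f i) \<in> A"
  by (induction I rule: infinite_finite_induct) (auto intro: one mult)

end

definition ideal_in :: "'a::comm_ring_1 set \<Rightarrow> 'a set \<Rightarrow> bool" where
  "ideal_in A I \<longleftrightarrow> I \<subseteq> A \<and> 0 \<in> I \<and> (\<forall>x\<in>I. \<forall>y\<in>I. x - y \<in> I) \<and> (\<forall>a\<in>A. \<forall>x\<in>I. a * x \<in> I)"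

lemma ideal_in_add:
  assumes "ideal_in A I" "x \<in> I" "y \<in> I"
  shows "x + y \<in> I"
proof -
  have "0 - y \<in> I" using assms unfolding ideal_in_def by blast
  then have "x - (0 - y) \<in> I" using assms unfolding ideal_in_def by blast
  then show ?thesis by simp
qed

text \<open>The hypothesis of Zorn's lemma for ideals not containing 1.\<close>
lemma ideal_in_Union_chain:
  assumes chain: "subset.chain {I. ideal_in A I \<and> 1 \<notin> I} C" and "C \<noteq> {}"
  shows "ideal_in A (\<Union>C) \<and> 1 \<notin> \<Union>C"
proof -
  have C: "\<And>I. I \<in> C \<Longrightarrow> ideal_in A I \<and> 1 \<notin> I"
    using chain by (auto simp: subset_chain_def)
  have "x - y \<in> \<Union>C" if x: "x \<in> \<Union>C" and y: "y \<in> \<Union>C" for x y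
  proof -
    obtain I K where IK: "I \<in> C" "K \<in> C" "x \<in> I" "y \<in> K" using x y by blast
    then have "I \<subseteq> K \<or> K \<subseteq> I" using chain by (auto simp: subset_chain_def)
    then show ?thesis using IK C[of I] C[of K] unfolding ideal_in_def by blast
  qed
  moreover have "0 \<in> \<Union>C" using C \<open>C \<noteq> {}\<close> unfolding ideal_in_def by blast
  moreover have "\<Union>C \<subseteq> A" "1 \<notin> \<Union>C" "\<forall>a\<in>A. \<forall>x\<in>\<Union>C. a * x \<in> \<Union>C"
    using C unfolding ideal_in_def by blast+
  ultimately show ?thesis unfolding ideal_in_def by blast
qed

text \<open>A maximal proper ideal \<open>M\<close> containing \<open>J\<close> is prime: if \<open>x \<notin> M\<close>, then the ideal \<open>M + A x\<close> contains 1, and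
multiplying \<open>1 = m + a x\<close> by \<open>y\<close> puts \<open>y\<close> into \<open>M\<close> as soon as \<open>x y\<close> lies there.\<close>
lemma (in unital_subring) obtain_prime_ideal:
  assumes J: "ideal_in A J" "1 \<notin> J"
  obtains M where "ideal_in A M" "J \<subseteq> M" "1 \<notin> M"
    "\<And>x y. x \<in> A \<Longrightarrow> y \<in> A \<Longrightarrow> x * y \<in> M \<Longrightarrow> x \<in> M \<or> y \<in> M"
proof -
  let ?P = "{I. ideal_in A I \<and> 1 \<notin> I}"
  have "\<exists>M\<in>?P. J \<subseteq> M \<and> (\<forall>X\<in>?P. M \<subseteq> X \<longrightarrow> X = M)"
  proof (rule subset_Zorn_nonempty[of "{I \<in> ?P. J \<subseteq> I}", THEN bexE])
    show "{I \<in> ?P. J \<subseteq> I} \<noteq> {}" using J by blast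
    show "\<Union>C \<in> {I \<in> ?P. J \<subseteq> I}" if C: "C \<noteq> {}" "subset.chain {I \<in> ?P. J \<subseteq> I} C" for C
    proof -
      have "subset.chain ?P C" using C(2) by (auto simp: subset_chain_def)
      then have "ideal_in A (\<Union>C) \<and> 1 \<notin> \<Union>C" using ideal_in_Union_chain C(1) by blast
      moreover have "J \<subseteq> \<Union>C"
      proof -
        obtain I where "I \<in> C" using C(1) by blast
        then have "J \<subseteq> I" using C(2) by (auto simp: subset_chain_def)
        then show ?thesis using \<open>I \<in> C\<close> by blast
      qed
      ultimately show ?thesis by blast
    qed
  next
    fix M assume "M \<in> {I \<in> ?P. J \<subseteq> I}" "\<forall>X\<in>{I \<in> ?P. J \<subseteq> I}. M \<subseteq> X \<longrightarrow> X = M"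
    then show ?thesis by (intro bexI[of _ M]) auto
  qed
  then obtain M where M': "M \<in> ?P" "J \<subseteq> M" "\<forall>X\<in>?P. M \<subseteq> X \<longrightarrow> X = M" by (elim bexE conjE)
  then have M: "ideal_in A M" "1 \<notin> M" "J \<subseteq> M" by simp_all
  have max: "X = M" if "ideal_in A X" "1 \<notin> X" "M \<subseteq> X" for X
    using M'(3) that by simp
  have "y \<in> M" if xy: "x \<in> A" "y \<in> A" "x * y \<in> M" "x \<notin> M" for x y
  proof -
    let ?X = "{m + a * x | m a. m \<in> M \<and> a \<in> A}"
    have M0: "M \<subseteq> A" "0 \<in> M" "\<And>x y. x \<in> M \<Longrightarrow> y \<in> M \<Longrightarrow> x - y \<in> M"
      "\<And>a x. a \<in> A \<Longrightarrow> x \<in> M \<Longrightarrow> a * x \<in> M" using M(1) unfolding ideal_in_def by blast+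
    have "ideal_in A ?X"
      unfolding ideal_in_def
    proof (intro conjI ballI)
      show "?X \<subseteq> A" using M0(1) mult xy(1) add by blast
      have "0 = 0 + 0 * x" by simp
      then show "0 \<in> ?X" using M0(2) zero by blast
    next
      fix u v assume "u \<in> ?X" "v \<in> ?X"
      then obtain m a m' a' where "u = m + a * x" "v = m' + a' * x" "m \<in> M" "m' \<in> M" "a \<in> A" "a' \<in> A"
        by blast
      then have "u - v = (m - m') + (a - a') * x" "m - m' \<in> M" "a - a' \<in> A"
        using M0(3) diff by (auto simp: algebra_simps)
      then show "u - v \<in> ?X" by blast
    next
      fix b u assume "b \<in> A" "u \<in> ?X"
      then obtain m a where "u = m + a * x" "m \<in> M" "a \<in> A" by blast
      then have "b * u = b * m + (b * a) * x" "b * m \<in> M" "b * a \<in> A"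
        using M0(4) mult \<open>b \<in> A\<close> by (auto simp: algebra_simps)
      then show "b * u \<in> ?X" by blast
    qed
    moreover have "M \<subseteq> ?X"
    proof
      fix m assume "m \<in> M"
      then have "m = m + 0 * x" by simp
      then show "m \<in> ?X" using \<open>m \<in> M\<close> zero by blast
    qed
    moreover have "x \<in> ?X"
    proof -
      have "x = 0 + 1 * x" by simp
      then show ?thesis using M0(2) one by blast
    qed
    ultimately have "1 \<in> ?X" using max[of ?X] xy(4) by blast
    then obtain m a where ma: "1 = m + a * x" "m \<in> M" "a \<in> A" by blast
    have "y = y * m + a * (x * y)"
      using arg_cong[OF ma(1), of "\<lambda>z. y * z"] by (simp add: algebra_simps)
    moreover have "y * m \<in> M" "a * (x * y) \<in> M" using M0(4) xy ma by blast+
    ultimately show "y \<in> M" using ideal_in_add[OF M(1)] by metis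
  qed
  then show ?thesis using that M by blast
qed

section \<open>The Frobenius map modulo a prime\<close>

text \<open>In the binomial expansion every inner coefficient is divisible by \<open>p\<close>. The error term is kept as an
explicit multiple of \<open>p\<close> inside the ring, because in the ambient ring \<open>p\<close> may be a unit.\<close>
lemma (in unital_subring) frobenius_add_prime:
  assumes "prime p"
    and xy: "x \<in> A" "y \<in> A"
  shows "\<exists>a\<in>A. (x + y) ^ p = x ^ p + y ^ p + of_nat p * a"
proof -
  have p: "p \<ge> 2" using assms(1) prime_ge_2_nat by blast
  let ?f = "\<lambda>k. of_nat (p choose k) * x ^ k * y ^ (p - k)"
  let ?g = "\<lambda>k. of_nat ((p choose k) div p) * x ^ k * y ^ (p - k)"
  have split: "{..p} = insert 0 (insert p {1..<p})" using p by auto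
  have "(x + y) ^ p = (\<Sum>k\<le>p. ?f k)" by (rule binomial_ring)
  also have "\<dots> = ?f 0 + (?f p + (\<Sum>k\<in>{1..<p}. ?f k))"
    unfolding split using p by (subst sum.insert; simp)+
  also have "(\<Sum>k\<in>{1..<p}. ?f k) = (\<Sum>k\<in>{1..<p}. of_nat p * ?g k)"
  proof (rule sum.cong[OF refl])
    fix k assume k: "k \<in> {1..<p}"
    have "p dvd (p choose k)" using dvd_choose_prime[of k p] assms(1) k by auto
    then have "p choose k = p * ((p choose k) div p)" by simp
    then have "(of_nat (p choose k) :: 'a) = of_nat p * of_nat ((p choose k) div p)"
      by (metis of_nat_mult)
    then show "?f k = of_nat p * ?g k" by (simp add: mult.assoc)
  qed
  also have "\<dots> = of_nat p * (\<Sum>k\<in>{1..<p}. ?g k)" by (rule sum_distrib_left[symmetric])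
  finally have "(x + y) ^ p = x ^ p + y ^ p + of_nat p * (\<Sum>k\<in>{1..<p}. ?g k)" by simp
  moreover have "(\<Sum>k\<in>{1..<p}. ?g k) \<in> A"
    by (intro sum mult nat pow xy)
  ultimately show ?thesis by blast
qed

lemma (in unital_subring) frobenius_add:
  assumes p: "prime p"
    and xy: "x \<in> A" "y \<in> A"
  shows "\<exists>a\<in>A. (x + y) ^ (p ^ n) = x ^ (p ^ n) + y ^ (p ^ n) + of_nat p * a"
proof (induction n)
  case 0
  show ?case by (intro bexI[of _ 0] zero) auto
next
  case (Suc n)
  note step = frobenius_add_prime[OF p]
  let ?X = "x ^ (p ^ n)" and ?Y = "y ^ (p ^ n)"
  obtain a where a: "a \<in> A" "(x + y) ^ (p ^ n) = ?X + ?Y + of_nat p * a" using Suc by blast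
  obtain b where b: "b \<in> A" "(?X + ?Y + of_nat p * a) ^ p = (?X + ?Y) ^ p + (of_nat p * a) ^ p + of_nat p * b"
    using step[of "?X + ?Y" "of_nat p * a"] add[OF pow[OF xy(1)] pow[OF xy(2)]] mult[OF nat a(1)] by blast
  obtain c where c: "c \<in> A" "(?X + ?Y) ^ p = ?X ^ p + ?Y ^ p + of_nat p * c"
    using step[of ?X ?Y] pow[OF xy(1)] pow[OF xy(2)] by blast
  obtain p' where p': "p = Suc p'" using p by (cases p) auto
  \<comment> \<open>The error term of the induction hypothesis survives the next \<open>p\<close>-th power as a multiple of \<open>p\<close>.\<close>
  have d: "(of_nat p * a) ^ p = of_nat p * (a * (of_nat p * a) ^ p')"
    by (subst (2) p') (simp add: mult.assoc)
  have "(x + y) ^ (p ^ Suc n) = ((x + y) ^ (p ^ n)) ^ p"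
    by (simp add: power_mult[symmetric] mult.commute)
  also have "\<dots> = ?X ^ p + ?Y ^ p + of_nat p * (c + a * (of_nat p * a) ^ p' + b)"
    unfolding a(2) b(2) c(2) d by (simp add: algebra_simps)
  also have "?X ^ p = x ^ (p ^ Suc n)" by (simp add: power_mult[symmetric] mult.commute)
  also have "?Y ^ p = y ^ (p ^ Suc n)" by (simp add: power_mult[symmetric] mult.commute)
  finally have "(x + y) ^ (p ^ Suc n) =
    x ^ (p ^ Suc n) + y ^ (p ^ Suc n) + of_nat p * (c + a * (of_nat p * a) ^ p' + b)" .
  moreover have "c + a * (of_nat p * a) ^ p' + b \<in> A"
    by (intro add mult pow nat a(1) b(1) c(1))
  ultimately show ?case by blast
qed

section \<open>Complex roots that become a finite field\<close>

text \<open>For \<open>q \<ge> 2\<close>, zero together with the roots of unity whose order divides \<open>q - 1\<close>; for a prime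
power \<open>q\<close>, the Teichmueller representatives of the field with \<open>q\<close> elements.\<close>
definition frobenius_fixed :: "nat \<Rightarrow> complex set" where
  "frobenius_fixed q = {z. z ^ q = z}"

text \<open>The polynomial \<open>X\<^sup>q - X\<close> is squarefree over the complex numbers, so it is the product of the linear
factors of its \<open>q\<close> roots. The last claim evaluates its derivative at a root; it is what separates
distinct roots modulo \<open>p\<close>, since \<open>q s\<^bsup>q-1\<^esup> - 1\<close> is congruent to \<open>-1\<close>.\<close>
lemma frobenius_fixed_product:
  assumes q: "q \<ge> 2"
  shows "finite (frobenius_fixed q)" "card (frobenius_fixed q) = q"
    "\<And>x. (\<Prod>t\<in>frobenius_fixed q. x - t) = x ^ q - x"
    "\<And>s. s \<in> frobenius_fixed q \<Longrightarrow> (\<Prod>t\<in>frobenius_fixed q - {s}. s - t) = of_nat q * s ^ (q - 1) - 1"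
proof -
  let ?T = "frobenius_fixed q"
  define P :: "complex poly" where "P = monom 1 q - monom 1 1"
  have poly: "poly P x = x ^ q - x" for x by (simp add: P_def poly_monom)
  have pd: "poly (pderiv P) x = of_nat q * x ^ (q - 1) - 1" for x
    by (simp add: P_def pderiv_diff pderiv_monom poly_monom)
  have deg: "degree P = q"
    proof (rule antisym)
    show "degree P \<le> q" unfolding P_def using q by (intro degree_diff_le) (auto simp: degree_monom_eq)
    show "q \<le> degree P" using q by (intro le_degree) (simp add: P_def)
  qed
  have "lead_coeff P = 1" unfolding deg using q by (simp add: P_def)
  have roots: "?T = {z. poly P z = 0}" by (auto simp: frobenius_fixed_def poly)
  have "P \<noteq> 0" using deg q by auto
  then show fin: "finite ?T" unfolding roots by (rule poly_roots_finite)
  have "rsquarefree P"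
    unfolding rsquarefree_roots
  proof (intro allI notI)
    fix a assume a: "poly P a = 0 \<and> poly (pderiv P) a = 0"
    have "a ^ q = a * a ^ (q - 1)" using q by (simp add: power_eq_if)
    moreover have "of_nat q * a ^ (q - 1) = 1" using a by (simp add: pd)
    ultimately have "a ^ q * of_nat q = a" by (simp add: mult_ac)
    moreover have "a ^ q = a" using a by (simp add: poly)
    ultimately have "a = 0" using q by simp
    then show False using a q by (simp add: pd zero_power)
  qed
  from complex_poly_decompose_rsquarefree[OF this]
  have P: "P = (\<Prod>z\<in>?T. [:-z, 1:])" unfolding roots \<open>lead_coeff P = 1\<close> by (metis smult_1_left)
  have "degree (\<Prod>z\<in>?T. [:-z, 1:]) = card ?T" by (subst degree_prod_sum_eq) auto
  then have "degree P = card ?T" by (simp only: P)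
  then show "card ?T = q" using deg by simp
  show "(\<Prod>t\<in>?T. x - t) = x ^ q - x" for x
  proof -
    have "poly P x = (\<Prod>t\<in>?T. x - t)" by (subst P) (simp add: poly_prod)
    then show ?thesis by (simp add: poly)
  qed
  fix s assume s: "s \<in> ?T"
  have "P = [:-s, 1:] * (\<Prod>z\<in>?T - {s}. [:-z, 1:])"
    by (subst P) (rule prod.remove[OF fin s])
  then have "pderiv P = [:-s, 1:] * pderiv (\<Prod>z\<in>?T - {s}. [:-z, 1:])
      + (\<Prod>z\<in>?T - {s}. [:-z, 1:]) * pderiv [:-s, 1:]"
    by (metis pderiv_mult)
  then have "poly (pderiv P) s = (\<Prod>t\<in>?T - {s}. s - t)"
    by (simp add: pderiv_pCons poly_prod)
  then show "(\<Prod>t\<in>?T - {s}. s - t) = of_nat q * s ^ (q - 1) - 1" by (simp add: pd)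
qed

lemma group_closure_mult:
  fixes T :: "'a::comm_ring_1 set"
  assumes T: "\<And>s t. s \<in> T \<Longrightarrow> t \<in> T \<Longrightarrow> s * t \<in> T"
    and "x \<in> group_closure T" "y \<in> group_closure T"
  shows "x * y \<in> group_closure T"
  using assms(2)
proof induction
  case (base s)
  show ?case using assms(3)
  proof induction
    case (base t)
    then show ?case using \<open>s \<in> insert 0 T\<close> T by (auto intro: group_closure.base)
  next
    case (diff u v)
    then show ?case using group_closure.diff by (metis right_diff_distrib)
  qed
next
  case (diff u v)
  then show ?case using group_closure.diff by (metis left_diff_distrib)
qed

lemma group_closure_coeffs:
  fixes T :: "'a::comm_ring_1 set"
  assumes fin: "finite T" and "x \<in> group_closure T"
  shows "\<exists>c. x = (\<Sum>t\<in>T. of_int (c t) * t)"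
  using assms(2)
proof induction
  case (base s)
  have "(\<Sum>t\<in>T. of_int (if t = s then 1 else 0) * t) = (\<Sum>t\<in>T. if t = s then t else 0)"
    by (intro sum.cong) auto
  then have "s = (\<Sum>t\<in>T. of_int (if t = s then 1 else 0) * t)"
    using base fin by (auto simp: sum.delta)
  then show ?case by (rule exI[of "\<lambda>c. s = (\<Sum>t\<in>T. of_int (c t) * t)"])
next
  case (diff u v)
  then obtain c d where "u = (\<Sum>t\<in>T. of_int (c t) * t)" "v = (\<Sum>t\<in>T. of_int (d t) * t)" by blast
  then have "u - v = (\<Sum>t\<in>T. of_int (c t - d t) * t)"
    by (simp add: sum_subtractf algebra_simps)
  then show ?case by (rule exI[of "\<lambda>c. u - v = (\<Sum>t\<in>T. of_int (c t) * t)"])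
qed

text \<open>Multiplication by \<open>x\<close> acts on the generators \<open>T\<close> by an integer matrix, with the vector of generators as
an eigenvector for \<open>x\<close>. Hence \<open>x\<close> is a root of a monic integer polynomial, the characteristic
polynomial of that matrix.\<close>
lemma algebraic_int_of_stable_lattice:
  fixes x :: "'a::field_char_0"
  assumes fin: "finite T" and nz: "\<exists>t\<in>T. t \<noteq> 0"
    and stable: "\<And>t. t \<in> T \<Longrightarrow> x * t \<in> group_closure T"
  shows "algebraic_int x"
proof -
  define n where "n = card T"
  obtain g where g: "bij_betw g {0..<n} T"
    using fin ex_bij_betw_nat_finite n_def by blast
  have gT: "g i \<in> T" if "i < n" for i using g that by (auto simp: bij_betw_def)
  have "\<forall>t\<in>T. \<exists>c. x * t = (\<Sum>s\<in>T. of_int (c s) * s)"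
    using group_closure_coeffs[OF fin] stable by blast
  then obtain c where c: "\<And>t. t \<in> T \<Longrightarrow> x * t = (\<Sum>s\<in>T. of_int (c t s) * s)" by metis
  define F :: "int mat" where "F = mat n n (\<lambda>(i, j). c (g i) (g j))"
  define C :: "'a mat" where "C = map_mat of_int F"
  define v where "v = vec n g"
  have F: "F \<in> carrier_mat n n" by (simp add: F_def)
  have C: "C \<in> carrier_mat n n" by (simp add: C_def F_def)
  have "C *\<^sub>v v = x \<cdot>\<^sub>v v"
  proof (rule eq_vecI)
    fix i assume "i < dim_vec (x \<cdot>\<^sub>v v)"
    then have i: "i < n" by (simp add: v_def)
    have "(C *\<^sub>v v) $ i = (\<Sum>j\<in>{0..<n}. of_int (c (g i) (g j)) * g j)"
      using i by (auto simp: C_def F_def v_def scalar_prod_def intro!: sum.cong)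
    also have "\<dots> = (\<Sum>s\<in>T. of_int (c (g i) s) * s)"
      by (rule sum.reindex_bij_betw[OF g])
    also have "\<dots> = x * g i" using c gT i by simp
    finally show "(C *\<^sub>v v) $ i = (x \<cdot>\<^sub>v v) $ i" using i by (simp add: v_def)
  qed (simp add: C_def F_def v_def)
  moreover have "v \<noteq> 0\<^sub>v n"
  proof
    assume "v = 0\<^sub>v n"
    then have "\<And>i. i < n \<Longrightarrow> v $ i = 0" by simp
    then have "\<And>i. i < n \<Longrightarrow> g i = 0" by (simp add: v_def)
    moreover have "T = g ` {0..<n}" using g by (simp add: bij_betw_def)
    ultimately show False using nz by auto
  qed
  moreover have "v \<in> carrier_vec n" by (simp add: v_def)
  ultimately have "eigenvalue C x" using C unfolding eigenvalue_def eigenvector_def by auto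
  then have "poly (char_poly C) x = 0" using eigenvalue_root_char_poly[OF C] by simp
  moreover have "char_poly C = map_poly of_int (char_poly F)"
    unfolding C_def by (rule of_int_hom.char_poly_hom[OF F])
  moreover have "lead_coeff (char_poly F) = 1" using degree_monic_char_poly[OF F] by auto
  ultimately show ?thesis unfolding algebraic_int_altdef_ipoly by metis
qed

text \<open>The set \<open>T\<close> plays the field with \<open>q\<close> elements, and \<open>f m x b\<close> plays \<open>m x + b\<close>. Only two consequences of the
field axioms are recorded: lines of one slope are disjoint, and lines of two different slopes share at
most one point.

Let \<open>A\<close> be the ring spanned by the fixed points \<open>T\<close> of \<open>z \<mapsto> z\<^sup>q\<close>, and \<open>M\<close> a prime ideal of \<open>A\<close> over \<open>p\<close>.
Modulo \<open>M\<close> the map \<open>z \<mapsto> z\<^sup>q\<close> is additive and fixes the generators, hence every \<open>x\<close> in \<open>A\<close>; so \<open>M\<close>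
contains \<open>x\<^sup>q - x\<close>, the product of the differences \<open>x - t\<close>, and by primality one of the factors. Thus
every residue class of \<open>A\<close> modulo \<open>M\<close> has a representative in \<open>T\<close>, and only one by the derivative of
\<open>X\<^sup>q - X\<close>. The function \<open>f\<close> sends \<open>m, x, b\<close> to the representative of \<open>m x + b\<close>.\<close>
lemma affine_plane_coordinates:
  assumes "primepow (q::nat)"
  obtains T :: "complex set" and f where
    "finite T" "card T = q"
    "\<And>m x b. m \<in> T \<Longrightarrow> x \<in> T \<Longrightarrow> b \<in> T \<Longrightarrow> f m x b \<in> T"
    "\<And>m x b b'. m \<in> T \<Longrightarrow> x \<in> T \<Longrightarrow> b \<in> T \<Longrightarrow> b' \<in> T \<Longrightarrow> f m x b = f m x b' \<Longrightarrow> b = b'"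
    "\<And>m m' x x' b b'. m \<in> T \<Longrightarrow> m' \<in> T \<Longrightarrow> x \<in> T \<Longrightarrow> x' \<in> T \<Longrightarrow> b \<in> T \<Longrightarrow> b' \<in> T \<Longrightarrow>
       m \<noteq> m' \<Longrightarrow> f m x b = f m' x b' \<Longrightarrow> f m x' b = f m' x' b' \<Longrightarrow> x = x'"
proof -
  obtain p n where p: "prime p" and n: "n > 0" and qpn: "q = p ^ n"
    using assms by (auto simp: primepow_def)
  have q: "q \<ge> 2" using primepow_gt_Suc_0[OF assms] by simp
  define T where "T = frobenius_fixed q"
  define A where "A = group_closure T"
  note T = frobenius_fixed_product[OF q, folded T_def]
  have T_mult: "s * t \<in> T" if "s \<in> T" "t \<in> T" for s t
    using that by (simp add: T_def frobenius_fixed_def power_mult_distrib)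
  have T1: "1 \<in> T" by (simp add: T_def frobenius_fixed_def)
  have TA: "t \<in> A" if "t \<in> T" for t using that by (auto simp: A_def intro: group_closure.base)
  interpret unital_subring A
  proof
    show "1 \<in> A" using TA T1 by blast
    show "x - y \<in> A" if "x \<in> A" "y \<in> A" for x y using that by (simp add: A_def group_closure.diff)
    show "x * y \<in> A" if "x \<in> A" "y \<in> A" for x y
      using that T_mult unfolding A_def by (intro group_closure_mult)
  qed
  define J where "J = (\<lambda>a. of_nat p * a) ` A"
  have J: "ideal_in A J"
    unfolding ideal_in_def
  proof (intro conjI ballI)
    show "J \<subseteq> A" by (auto simp: J_def intro: mult nat)
    show "0 \<in> J" using zero by (force simp: J_def)
    show "x - y \<in> J" if xy: "x \<in> J" "y \<in> J" for x y
    proof -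
      obtain a b where "a \<in> A" "b \<in> A" "x = of_nat p * a" "y = of_nat p * b" using xy by (auto simp: J_def)
      then have "x - y = of_nat p * (a - b)" "a - b \<in> A" by (auto simp: algebra_simps intro: diff)
      then show ?thesis by (auto simp: J_def)
    qed
    show "a * x \<in> J" if ax: "a \<in> A" "x \<in> J" for a x
    proof -
      obtain b where "b \<in> A" "x = of_nat p * b" using ax by (auto simp: J_def)
      then have "a * x = of_nat p * (a * b)" "a * b \<in> A" using ax by (auto intro: mult)
      then show ?thesis by (auto simp: J_def)
    qed
  qed
  \<comment> \<open>Otherwise \<open>1 / p\<close> lies in \<open>A\<close>, and multiplication by it maps the lattice \<open>A\<close> into itself, which makes
    \<open>1 / p\<close> an algebraic integer.\<close>
  have "1 \<notin> J"
  proof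
    assume "1 \<in> J"
    then obtain a where a: "a \<in> A" "of_nat p * a = 1" by (auto simp: J_def)
    have "algebraic_int a"
    proof (rule algebraic_int_of_stable_lattice[OF T(1)])
      show "\<exists>t\<in>T. t \<noteq> 0" using T1 by (intro bexI[of _ 1]) auto
      show "a * t \<in> group_closure T" if "t \<in> T" for t
        using mult[OF a(1) TA[OF that]] by (simp add: A_def)
    qed
    moreover have "a = 1 / of_nat p"
      using a(2) prime_gt_0_nat[OF p] by (simp add: eq_divide_eq mult.commute)
    then have "a \<in> \<rat>" by simp
    ultimately have "a \<in> \<int>" by (rule rational_algebraic_int_is_int)
    then obtain k where "a = of_int k" by (elim Ints_cases)
    then have "(of_int (int p * k) :: complex) = of_int 1" using a(2) by simp
    then have "int p * k = 1" by (simp only: of_int_eq_iff)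
    then have "int p dvd 1" by (metis dvd_triv_left)
    then show False using p by (simp add: prime_nat_iff)
  qed
  obtain M where M: "ideal_in A M" and JM: "J \<subseteq> M" and M1: "1 \<notin> M"
    and prime: "\<And>x y. x \<in> A \<Longrightarrow> y \<in> A \<Longrightarrow> x * y \<in> M \<Longrightarrow> x \<in> M \<or> y \<in> M"
    using obtain_prime_ideal[OF J \<open>1 \<notin> J\<close>] by blast
  have M0: "0 \<in> M" "\<And>x y. x \<in> M \<Longrightarrow> y \<in> M \<Longrightarrow> x - y \<in> M"
      "\<And>a x. a \<in> A \<Longrightarrow> x \<in> M \<Longrightarrow> a * x \<in> M" using M(1) unfolding ideal_in_def by blast+
  have pM: "of_nat p * a \<in> M" if "a \<in> A" for a using JM that by (auto simp: J_def)
  have prime_prod: "\<exists>t\<in>S. g t \<in> M"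
    if "finite S" "\<And>t. t \<in> S \<Longrightarrow> g t \<in> A" "(\<Prod>t\<in>S. g t) \<in> M" for S and g :: "complex \<Rightarrow> complex"
    using that
  proof (induction S rule: finite_induct)
    case empty
    then show ?case using M1 by simp
  next
    case (insert s S)
    then have "g s \<in> M \<or> (\<Prod>t\<in>S. g t) \<in> M" by (intro prime prod) auto
    then show ?case using insert by blast
  qed
  have frob: "x ^ q - x \<in> M" if "x \<in> A" for x
    using that unfolding A_def
  proof induction
    case (base s)
    then have "s ^ q - s = 0" using q by (auto simp: T_def frobenius_fixed_def)
    then show ?case using M0(1) by simp
  next
    case (diff u v)
    then have uv: "u \<in> A" "v \<in> A" by (simp_all add: A_def)
    then have "u - v \<in> A" by (rule unital_subring.diff[OF unital_subring_axioms])
    \<comment> \<open>Adding \<open>v\<close> back avoids the sign of \<open>(- v) ^ q\<close>, which depends on the parity of \<open>q\<close>.\<close>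
    from frobenius_add[OF p this uv(2), of n] obtain a
      where a: "a \<in> A" "u ^ q = (u - v) ^ q + v ^ q + of_nat p * a" by (auto simp: qpn)
    have "(u - v) ^ q - (u - v) = ((u ^ q - u) - (v ^ q - v)) - of_nat p * a"
      using a(2) by simp
    also have "\<dots> \<in> M" using M0(2) pM a(1) diff.IH by blast
    finally show ?case .
  qed
  have T_inj: "s = t" if st: "s \<in> T" "t \<in> T" "s - t \<in> M" for s t
  proof (rule ccontr)
    assume "s \<noteq> t"
    then have "(\<Prod>t\<in>T - {s}. s - t) = (s - t) * (\<Prod>t\<in>T - {s} - {t}. s - t)"
      using T(1) st by (intro prod.remove) auto
    also have "\<dots> = (\<Prod>t\<in>T - {s} - {t}. s - t) * (s - t)" by (rule mult.commute)
    also have "\<dots> \<in> M" using st TA by (intro M0(3) prod diff) auto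
    finally have "of_nat q * s ^ (q - 1) - 1 \<in> M" using T(4)[OF st(1)] by simp
    moreover have "(of_nat q :: complex) * s ^ (q - 1) = of_nat p * (of_nat (p ^ (n - 1)) * s ^ (q - 1))"
      using n unfolding qpn by (cases n) (simp_all add: mult.assoc)
    then have "of_nat q * s ^ (q - 1) \<in> M" using pM mult nat pow TA st(1) by metis
    ultimately have "of_nat q * s ^ (q - 1) - (of_nat q * s ^ (q - 1) - 1) \<in> M" by (rule M0(2)[rotated])
    then show False using M1 by simp
  qed
  have "\<exists>t\<in>T. x - t \<in> M" if x: "x \<in> A" for x
    using prime_prod[OF T(1), of "\<lambda>t. x - t"] frob[OF x] T(3)[of x] diff[OF x TA] by auto
  then obtain r where r: "\<And>x. x \<in> A \<Longrightarrow> r x \<in> T" "\<And>x. x \<in> A \<Longrightarrow> x - r x \<in> M" by metis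
  have r_eq: "x - y \<in> M" if "x \<in> A" "y \<in> A" "r x = r y" for x y
  proof -
    have "(x - r x) - (y - r y) \<in> M" using M0(2) r(2) that by blast
    then show ?thesis using that(3) by simp
  qed
  have line: "m * x + b \<in> A" if "m \<in> T" "x \<in> T" "b \<in> T" for m x b
    using that TA by (intro add mult) auto
  show ?thesis
  proof (rule that[of T "\<lambda>m x b. r (m * x + b)"])
    show "finite T" "card T = q" by (rule T)+
    show "r (m * x + b) \<in> T" if "m \<in> T" "x \<in> T" "b \<in> T" for m x b
      using r(1) line that by blast
  next
    fix m x b b' assume *: "m \<in> T" "x \<in> T" "b \<in> T" "b' \<in> T" "r (m * x + b) = r (m * x + b')"
    then have "(m * x + b) - (m * x + b') \<in> M" by (intro r_eq line)
    then show "b = b'" using T_inj * by simp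
  next
    fix m m' x x' b b'
    assume *: "m \<in> T" "m' \<in> T" "x \<in> T" "x' \<in> T" "b \<in> T" "b' \<in> T" "m \<noteq> m'"
      "r (m * x + b) = r (m' * x + b')" "r (m * x' + b) = r (m' * x' + b')"
    \<comment> \<open>The intercepts cancel, leaving \<open>(m - m') (x - x')\<close> in the prime ideal.\<close>
    have "((m * x + b) - (m' * x + b')) - ((m * x' + b) - (m' * x' + b')) \<in> M"
      using * by (intro M0(2) r_eq line) auto
    also have "((m * x + b) - (m' * x + b')) - ((m * x' + b) - (m' * x' + b')) = (m - m') * (x - x')"
      by (simp add: algebra_simps)
    finally have "m - m' \<in> M \<or> x - x' \<in> M" using * TA by (intro prime diff) auto
    then show "x = x'" using T_inj * by blast
  qed
qed

section \<open>The affine plane of order q\<close>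

text \<open>The slope is an option: \<open>None\<close> is the vertical direction, whose lines are indexed by their first
coordinate.\<close>
definition plane_line :: "'a set \<Rightarrow> ('a \<Rightarrow> 'a \<Rightarrow> 'a \<Rightarrow> 'a) \<Rightarrow> 'a option \<Rightarrow> 'a \<Rightarrow> ('a \<times> 'a) set" where
  "plane_line T f s b = (case s of Some m \<Rightarrow> (\<lambda>x. (x, f m x b)) ` T | None \<Rightarrow> (\<lambda>y. (b, y)) ` T)"

text \<open>The \<open>q + 1\<close> parts are matched with the \<open>q + 1\<close> directions of the plane, and the \<open>q\<close> vertices of a part
with the \<open>q\<close> parallel lines of its direction. Points are numbered below \<open>q\<^sup>2\<close> so that they can serve as
coordinates of vectors.\<close>
lemma affine_plane_lines:
  assumes q: "primepow q"
    and P: "disjoint P" "card P = q + 1" "\<forall>A\<in>P. card A = q"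
  obtains L :: "'v \<Rightarrow> nat set" where
    "\<And>v. v \<in> \<Union>P \<Longrightarrow> L v \<subseteq> {..<q * q} \<and> card (L v) = q"
    "\<And>A u v. A \<in> P \<Longrightarrow> u \<in> A \<Longrightarrow> v \<in> A \<Longrightarrow> u \<noteq> v \<Longrightarrow> L u \<inter> L v = {}"
    "\<And>A B u v i j. A \<in> P \<Longrightarrow> B \<in> P \<Longrightarrow> A \<noteq> B \<Longrightarrow> u \<in> A \<Longrightarrow> v \<in> B \<Longrightarrow>
       i \<in> L u \<inter> L v \<Longrightarrow> j \<in> L u \<inter> L v \<Longrightarrow> i = j"
proof -
  obtain T :: "complex set" and f where T: "finite T" "card T = q"
    and f: "\<And>m x b. m \<in> T \<Longrightarrow> x \<in> T \<Longrightarrow> b \<in> T \<Longrightarrow> f m x b \<in> T"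
    and f_inj: "\<And>m x b b'. m \<in> T \<Longrightarrow> x \<in> T \<Longrightarrow> b \<in> T \<Longrightarrow> b' \<in> T \<Longrightarrow> f m x b = f m x b' \<Longrightarrow> b = b'"
    and f_meet: "\<And>m m' x x' b b'. m \<in> T \<Longrightarrow> m' \<in> T \<Longrightarrow> x \<in> T \<Longrightarrow> x' \<in> T \<Longrightarrow> b \<in> T \<Longrightarrow> b' \<in> T \<Longrightarrow>
       m \<noteq> m' \<Longrightarrow> f m x b = f m' x b' \<Longrightarrow> f m x' b = f m' x' b' \<Longrightarrow> x = x'"
    using affine_plane_coordinates[OF q] by blast
  let ?S = "insert None (Some ` T)"
  have "q > 0" using primepow_gt_Suc_0[OF q] by simp
  have "finite P" using P(2) card_ge_0_finite[of P] by simp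
  moreover have "card ?S = q + 1" using T by (simp add: card_image)
  ultimately obtain s where s: "bij_betw s P ?S"
    using finite_same_card_bij[of P ?S] T(1) P(2) by auto
  have "\<forall>A\<in>P. \<exists>g. bij_betw g A T"
  proof
    fix A assume "A \<in> P"
    then have "card A = q" using P(3) by blast
    moreover from this have "finite A" using card_ge_0_finite[of A] \<open>q > 0\<close> by simp
    ultimately show "\<exists>g. bij_betw g A T" using finite_same_card_bij[of A T] T by simp
  qed
  then obtain g where g: "\<And>A. A \<in> P \<Longrightarrow> bij_betw (g A) A T" by metis
  have "card (T \<times> T) = card {..<q * q}" using T by (simp add: card_cartesian_product)
  then obtain e where e: "bij_betw e (T \<times> T) {..<q * q}"
    using finite_same_card_bij[of "T \<times> T" "{..<q * q}"] T by auto
  define part where "part v = (THE A. A \<in> P \<and> v \<in> A)" for v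
  have part: "part v = A" if "A \<in> P" "v \<in> A" for v A
    unfolding part_def using that P(1) by (intro the_equality) (auto simp: disjoint_def)
  define K where "K v = plane_line T f (s (part v)) (g (part v) v)" for v
  have K_eq: "K v = plane_line T f (s A) (g A v)" if "A \<in> P" "v \<in> A" for A v
    using part[OF that] by (simp add: K_def)
  have sS: "s A \<in> ?S" if "A \<in> P" for A using s that by (auto simp: bij_betw_def)
  have gT: "g A v \<in> T" if "A \<in> P" "v \<in> A" for A v using g that by (auto simp: bij_betw_def)
  have K: "K v \<subseteq> T \<times> T \<and> card (K v) = q" if "A \<in> P" "v \<in> A" for A v
  proof (cases "s A")
    case None
    then show ?thesis unfolding K_eq[OF that] plane_line_def
      using gT[OF that] T by (auto simp: card_image inj_on_def)
  next
    case (Some m)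
    then have "m \<in> T" using sS[OF that(1)] by auto
    then show ?thesis unfolding K_eq[OF that] plane_line_def Some
      using gT[OF that] T f by (auto simp: card_image inj_on_def)
  qed
  have K_parallel: "K u \<inter> K v = {}" if A: "A \<in> P" "u \<in> A" "v \<in> A" "u \<noteq> v" for A u v
  proof -
    have ne: "g A u \<noteq> g A v" using g[OF A(1)] A by (auto simp: bij_betw_def inj_on_def)
    show ?thesis
    proof (cases "s A")
      case None
      then show ?thesis
        using ne unfolding K_eq[OF A(1,2)] K_eq[OF A(1,3)] plane_line_def by auto
    next
      case (Some m)
      then have m: "m \<in> T" using sS[OF A(1)] by auto
      have "f m x (g A u) \<noteq> f m x (g A v)" if "x \<in> T" for x
        using f_inj[OF m that gT[OF A(1,2)] gT[OF A(1,3)]] ne by blast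
      then show ?thesis
        using Some unfolding K_eq[OF A(1,2)] K_eq[OF A(1,3)] plane_line_def by auto
    qed
  qed
  have K_meet: "a = a'" if AB: "A \<in> P" "B \<in> P" "A \<noteq> B" "u \<in> A" "v \<in> B"
      and a: "a \<in> K u \<inter> K v" "a' \<in> K u \<inter> K v" for A B u v a a'
  proof -
    have ne: "s A \<noteq> s B" using s AB by (auto simp: bij_betw_def inj_on_def)
    have ST: "m \<in> T" if "s A = Some m \<or> s B = Some m" for m using sS[OF AB(1)] sS[OF AB(2)] that by auto
    have ab: "g A u \<in> T" "g B v \<in> T" using gT AB by blast+
    note a = a[unfolded K_eq[OF AB(1,4)] K_eq[OF AB(2,5)]]
    show ?thesis
    proof (cases "s A")
      case None
      then obtain m where "s B = Some m" using ne by (cases "s B") auto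
      then show ?thesis using a None by (auto simp: plane_line_def)
    next
      case (Some m)
      show ?thesis
      proof (cases "s B")
        case None
        then show ?thesis using a Some by (auto simp: plane_line_def)
      next
        case (Some m')
        with \<open>s A = Some m\<close> obtain x x' where
          x: "x \<in> T" "x' \<in> T" "a = (x, f m x (g A u))" "a' = (x', f m x' (g A u))"
          "f m x (g A u) = f m' x (g B v)" "f m x' (g A u) = f m' x' (g B v)"
          using a by (auto simp: plane_line_def)
        moreover have "m \<noteq> m'" using ne Some \<open>s A = Some m\<close> by simp
        ultimately have "x = x'" using f_meet[of m m' x x'] ST ab Some \<open>s A = Some m\<close> by blast
        then show ?thesis using x by simp
      qed
    qed
  qed
  have e_inj: "inj_on e (T \<times> T)" and e_im: "e ` (T \<times> T) = {..<q * q}" using e by (auto simp: bij_betw_def)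
  have e_int: "e ` K u \<inter> e ` K v = e ` (K u \<inter> K v)" if "u \<in> \<Union>P" "v \<in> \<Union>P" for u v
    using inj_on_image_Int[OF e_inj, of "K u" "K v"] K that by blast
  show ?thesis
  proof (rule that[of "\<lambda>v. e ` K v"])
    fix v assume "v \<in> \<Union>P"
    then have "K v \<subseteq> T \<times> T" "card (K v) = q" using K by blast+
    then show "e ` K v \<subseteq> {..<q * q} \<and> card (e ` K v) = q"
      using e_im card_image[OF inj_on_subset[OF e_inj]] by blast
  next
    fix A u v assume *: "A \<in> P" "u \<in> A" "v \<in> A" "u \<noteq> v"
    then show "e ` K u \<inter> e ` K v = {}" using e_int[of u v] K_parallel[OF *] by auto
  next
    fix A B u v i j
    assume *: "A \<in> P" "B \<in> P" "A \<noteq> B" "u \<in> A" "v \<in> B"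
      and ij: "i \<in> e ` K u \<inter> e ` K v" "j \<in> e ` K u \<inter> e ` K v"
    have "e ` K u \<inter> e ` K v = e ` (K u \<inter> K v)" using e_int * by blast
    then obtain a a' where "i = e a" "j = e a'" "a \<in> K u \<inter> K v" "a' \<in> K u \<inter> K v"
      using ij by (metis imageE)
    then show "i = j" using K_meet[OF *, of a a'] by simp
  qed
qed

section \<open>Subspaces of coordinate space\<close>

text \<open>The witness is the span of the unit vectors indexed by \<open>S\<close>.\<close>
lemma coordinate_subspace:
  assumes S: "S \<subseteq> {..<t}"
  obtains W :: "'f::field vec set" where "is_subspace_of_dim t W (card S)" "W \<subseteq> carrier_vec t"
    "\<And>x i. x \<in> W \<Longrightarrow> i < t \<Longrightarrow> i \<notin> S \<Longrightarrow> x $ i = 0"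
proof -
  interpret vec_space "TYPE('f)" t .
  let ?U = "unit_vec t ` S :: 'f vec set"
  have fin: "finite S" using S finite_subset by blast
  have U_units: "?U \<subseteq> set (unit_vecs t)" using S by (auto simp: unit_vecs_def)
  have U: "?U \<subseteq> carrier_vec t" by auto
  have sub: "subspace class_ring (span ?U) V" using span_is_subspace U by simp
  have subm: "submodule class_ring (span ?U) V" using span_is_submodule U by simp
  have own: "?U \<subseteq> span ?U" using in_own_span U by simp
  have vs: "vectorspace class_ring (vs (span ?U))" using subspace_is_vs[OF sub] .
  have "lin_indpt ?U"
    using unit_vecs_basis subset_li_is_li[OF _ U_units] unfolding basis_def by blast
  then have "vectorspace.basis class_ring (vs (span ?U)) ?U"
    using span_li_not_depend[OF own subm] own
    unfolding vectorspace.basis_def[OF vs] by simp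
  then have "vectorspace.dim class_ring (vs (span ?U)) = card ?U"
    using vectorspace.dim_basis[OF vs] fin by blast
  also have "card ?U = card S"
  proof (rule card_image, rule inj_onI)
    fix i j assume "i \<in> S" "j \<in> S" "(unit_vec t i :: 'f vec) = unit_vec t j"
    then show "i = j" using S unit_vec_eq[of i t j] by auto
  qed
  finally have "is_subspace_of_dim t (span ?U) (card S)"
    using sub unfolding is_subspace_of_dim_def by simp
  moreover have "x $ i = 0" if x: "x \<in> span ?U" "i < t" "i \<notin> S" for x i
  proof -
    obtain a where "x = lincomb a ?U" using x(1) finite_span[of ?U] fin U by auto
    then have "x $ i = (\<Sum>u\<in>?U. a u * u $ i)" using lincomb_index[OF x(2) U] by simp
    also have "\<dots> = 0"
    proof (rule sum.neutral, rule ballI)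
      fix u assume "u \<in> ?U"
      then obtain j where "u = unit_vec t j" "j \<in> S" by blast
      moreover from this have "j < t" "i \<noteq> j" using S x(3) by auto
      ultimately show "a u * u $ i = 0" using x(2) by simp
    qed
    finally show ?thesis .
  qed
  moreover have "span ?U \<subseteq> carrier_vec t" using span_closed[of ?U] U by auto
  ultimately show ?thesis using that by blast
qed

text \<open>The dimension is defined as the least size of a finite generating set, so a basis has to be shown to
exist first: independent subsets of \<open>W\<close> have at most \<open>t\<close> elements, and a maximal one is a basis.\<close>
lemma subspace_obtain_independent:
  fixes W :: "'f::field vec set"
  assumes "is_subspace_of_dim t W n"
  obtains B where "finite B" "card B = n" "B \<subseteq> carrier_vec t"
    "\<not> module.lin_dep class_ring (module_vec TYPE('f) t) B"
    "\<And>a. module.lincomb (module_vec TYPE('f) t) a B \<in> W"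
proof -
  interpret vec_space "TYPE('f)" t .
  have sub: "subspace class_ring W V" and dim: "vectorspace.dim class_ring (vs W) = n"
    using assms unfolding is_subspace_of_dim_def by auto
  have subm: "submodule class_ring W V" using is_module[OF sub] .
  have W: "W \<subseteq> carrier_vec t" using submodule.subset[OF subm] by simp
  have vs: "vectorspace class_ring (vs W)" using subspace_is_vs[OF sub] .
  have li: "module.lin_dep class_ring (vs W) S \<longleftrightarrow> lin_dep S" if "S \<subseteq> W" for S
    using span_li_not_depend(2)[OF that subm] .
  have "\<exists>B. finite B \<and> maximal B (\<lambda>S. S \<subseteq> W \<and> lin_indpt S)"
  proof (rule maximal_exists[of _ t "{}"])
    show "finite S \<and> card S \<le> t" if "S \<subseteq> W \<and> lin_indpt S" for S
      using li_le_dim[OF fin_dim, of S] subset_trans[of S W] that W by (auto simp: dim_is_n)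
    show "{} \<subseteq> W \<and> lin_indpt {}" by (simp add: lin_dep_def)
  qed
  then obtain B where B: "finite B" "maximal B (\<lambda>S. S \<subseteq> W \<and> lin_indpt S)" by blast
  then have BW: "B \<subseteq> W" "lin_indpt B" by (auto simp: maximal_def)
  have "maximal B (\<lambda>S. S \<subseteq> carrier (vs W) \<and> \<not> module.lin_dep class_ring (vs W) S)"
    using B(2) li unfolding maximal_def by auto
  then have "vectorspace.basis class_ring (vs W) B" by (rule vectorspace.max_li_is_basis[OF vs])
  then have "card B = n" using vectorspace.dim_basis[OF vs B(1)] dim by simp
  moreover have "lincomb a B \<in> W" for a
  proof -
    have "lincomb a B \<in> span B" unfolding span_def using B(1) by auto
    then show ?thesis using span_is_subset[OF BW(1) subm] by auto
  qed
  ultimately show ?thesis using that B(1) BW W by auto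
qed

text \<open>Padding the system with zero equations makes its matrix square and singular.\<close>
lemma homogeneous_system_solution:
  fixes a :: "nat \<Rightarrow> nat \<Rightarrow> 'f::field"
  assumes "m < n"
  obtains c where "\<exists>j<n. c j \<noteq> 0" "\<And>i. i < m \<Longrightarrow> (\<Sum>j<n. a i j * c j) = 0"
proof -
  define A where "A = mat n n (\<lambda>(i, j). if i < m then a i j else 0)"
  have A: "A \<in> carrier_mat n n" by (simp add: A_def)
  have "transpose_mat A *\<^sub>v unit_vec n m = 0\<^sub>v n"
    using assms by (intro eq_vecI) (auto simp: A_def)
  moreover have "unit_vec n m \<noteq> (0\<^sub>v n :: 'f vec)" using assms by simp
  ultimately have "\<exists>v. v \<in> carrier_vec n \<and> v \<noteq> 0\<^sub>v n \<and> transpose_mat A *\<^sub>v v = 0\<^sub>v n"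
    by (intro exI[of _ "unit_vec n m"]) simp
  then have "det (transpose_mat A) = 0"
    using det_0_iff_vec_prod_zero_field[of "transpose_mat A" n] A by simp
  then have "det A = 0" using det_transpose[OF A] by simp
  then obtain v where v: "v \<in> carrier_vec n" "v \<noteq> 0\<^sub>v n" "A *\<^sub>v v = 0\<^sub>v n"
    using det_0_iff_vec_prod_zero_field[OF A] by blast
  show ?thesis
  proof (rule that[of "\<lambda>j. v $ j"])
    show "\<exists>j<n. v $ j \<noteq> 0"
    proof (rule ccontr)
      assume "\<not> (\<exists>j<n. v $ j \<noteq> 0)"
      then have "v = 0\<^sub>v n" using v(1) by (intro eq_vecI) auto
      then show False using v(2) by simp
    qed
    fix i assume i: "i < m"
    have "(A *\<^sub>v v) $ i = 0" using v(3) i assms by simp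
    then show "(\<Sum>j<n. a i j * v $ j) = 0"
      using i assms v(1) by (simp add: A_def scalar_prod_def atLeast0LessThan)
  qed
qed

section \<open>Subspace choosability\<close>

text \<open>One proof serves both inner products: \<open>\<sigma>\<close> is the identity for the bilinear one and complex conjugation
for the Hermitian one. The involution \<open>\<sigma>\<close> makes orthogonality a symmetric relation.\<close>
locale sesquilinear_dot =
  fixes ip :: "'f::field vec \<Rightarrow> 'f vec \<Rightarrow> 'f" and \<sigma> :: "'f \<Rightarrow> 'f"
  assumes ip: "x \<in> carrier_vec t \<Longrightarrow> y \<in> carrier_vec t \<Longrightarrow> ip x y = (\<Sum>i<t. x $ i * \<sigma> (y $ i))"
    and \<sigma>_add: "\<sigma> (a + b) = \<sigma> a + \<sigma> b" and \<sigma>_mult: "\<sigma> (a * b) = \<sigma> a * \<sigma> b"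
    and \<sigma>_invol: "\<sigma> (\<sigma> a) = a" and \<sigma>_zero: "\<sigma> 0 = 0"
begin

lemma ip_swap:
  assumes "x \<in> carrier_vec t" "y \<in> carrier_vec t"
  shows "ip y x = \<sigma> (ip x y)"
proof -
  have "\<sigma> (\<Sum>i<n. x $ i * \<sigma> (y $ i)) = (\<Sum>i<n. y $ i * \<sigma> (x $ i))" for n
    by (induction n) (simp_all add: \<sigma>_zero \<sigma>_add \<sigma>_mult \<sigma>_invol mult.commute)
  then show ?thesis using assms by (simp add: ip)
qed

text \<open>The product \<open>ip x y\<close> is linear in \<open>x\<close>, so orthogonality to \<open>Y\<close> imposes fewer homogeneous equations
on the coefficients of \<open>x\<close> in a basis than there are coefficients.\<close>
lemma nonzero_orthogonal_vector:
  assumes W: "is_subspace_of_dim t W n" and Y: "finite Y" "Y \<subseteq> carrier_vec t" "card Y < n"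
  obtains x where "x \<in> W" "x \<in> carrier_vec t" "x \<noteq> 0\<^sub>v t" "\<And>y. y \<in> Y \<Longrightarrow> ip x y = 0"
proof -
  interpret vec_space "TYPE('f)" t .
  obtain B where B: "finite B" "card B = n" "B \<subseteq> carrier_vec t" "lin_indpt B"
    "\<And>a. lincomb a B \<in> W" using subspace_obtain_independent[OF W] by blast
  obtain g where g: "bij_betw g {..<n} B"
    using B(1,2) ex_bij_betw_nat_finite[of B] by (auto simp: atLeast0LessThan)
  obtain h where h: "bij_betw h {..<card Y} Y"
    using Y(1) ex_bij_betw_nat_finite[of Y] by (auto simp: atLeast0LessThan)
  obtain c where c: "\<exists>j<n. c j \<noteq> 0"
    "\<And>i. i < card Y \<Longrightarrow> (\<Sum>j<n. ip (g j) (h i) * c j) = 0"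
    using homogeneous_system_solution[OF Y(3), of "\<lambda>i j. ip (g j) (h i)"] by blast
  define a where "a b = c (the_inv_into {..<n} g b)" for b
  have ag: "a (g j) = c j" if "j < n" for j
    using that g by (simp add: a_def bij_betw_def the_inv_into_f_f)
  let ?x = "lincomb a B"
  have x: "?x \<in> carrier_vec t" using B(3) by simp
  have "ip ?x y = 0" if y: "y \<in> Y" for y
  proof -
    obtain i where i: "i < card Y" "y = h i" using h y by (auto simp: bij_betw_def)
    have yc: "y \<in> carrier_vec t" using y Y by blast
    have "ip ?x y = (\<Sum>k<t. (\<Sum>b\<in>B. a b * b $ k) * \<sigma> (y $ k))"
      using ip[OF x yc] lincomb_index[OF _ B(3)] by simp
    also have "\<dots> = (\<Sum>b\<in>B. a b * (\<Sum>k<t. b $ k * \<sigma> (y $ k)))"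
      by (simp add: sum_distrib_left sum_distrib_right mult.assoc) (rule sum.swap)
    also have "\<dots> = (\<Sum>b\<in>B. a b * ip b y)"
      using B(3) yc by (intro sum.cong refl) (subst ip[of _ t], auto)
    also have "\<dots> = (\<Sum>j<n. a (g j) * ip (g j) y)"
      by (rule sum.reindex_bij_betw[OF g, symmetric])
    also have "\<dots> = (\<Sum>j<n. ip (g j) (h i) * c j)"
      unfolding i(2) by (intro sum.cong refl) (simp add: ag mult.commute)
    also have "\<dots> = 0" by (rule c(2)[OF i(1)])
    finally show ?thesis .
  qed
  moreover have "?x \<noteq> 0\<^sub>v t"
  proof
    assume "?x = 0\<^sub>v t"
    then have "a b = 0" if "b \<in> B" for b
      using not_lindepD[OF B(4) B(1), of a] that by auto
    then show False using c(1) ag g by (force simp: bij_betw_def)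
  qed
  ultimately show ?thesis using that[of ?x] x B(5) by blast
qed

text \<open>Choosing the vectors greedily, each orthogonal to all earlier ones. This is needed because the subspace
choice number is a least element: without some choosable \<open>k\<close> it would have no determined value.\<close>
lemma subspace_choosable_Suc_card:
  assumes G: "pair_graph G"
  shows "subspace_choosable ip G (Suc (card (pverts G)))"
  unfolding subspace_choosable_def
proof (intro allI impI)
  interpret pair_graph G by (rule G)
  fix t and W :: "'a \<Rightarrow> 'f vec set"
  let ?k = "Suc (card (pverts G))"
  assume W: "\<forall>v\<in>pverts G. is_subspace_of_dim t (W v) ?k"
  have "\<exists>x. (\<forall>v\<in>U. x v \<in> W v \<and> x v \<in> carrier_vec t \<and> x v \<noteq> 0\<^sub>v t) \<and>
      (\<forall>u\<in>U. \<forall>v\<in>U. u \<noteq> v \<longrightarrow> ip (x u) (x v) = 0)"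
    if "finite U" "U \<subseteq> pverts G" for U
    using that
  proof (induction U rule: finite_induct)
    case empty
    then show ?case by simp
  next
    case (insert w U)
    then obtain x where x: "\<forall>v\<in>U. x v \<in> W v \<and> x v \<in> carrier_vec t \<and> x v \<noteq> 0\<^sub>v t"
      "\<forall>u\<in>U. \<forall>v\<in>U. u \<noteq> v \<longrightarrow> ip (x u) (x v) = 0" by blast
    have "card (x ` U) \<le> card (pverts G)"
      using insert card_image_le[of U x] card_mono[of "pverts G" U] pair_finite_verts by force
    then obtain z where z: "z \<in> W w" "z \<in> carrier_vec t" "z \<noteq> 0\<^sub>v t" "\<And>y. y \<in> x ` U \<Longrightarrow> ip z y = 0"
      using nonzero_orthogonal_vector[of t "W w" ?k "x ` U"] W insert x(1) by auto
    have "ip (x u) z = 0" if "u \<in> U" for u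
      using ip_swap[of z t "x u"] z x(1) that by (simp add: \<sigma>_zero)
    then show ?case
      using x z insert.hyps(2) by (intro exI[of _ "x(w := z)"]) auto
  qed
  from this[OF pair_finite_verts subset_refl] obtain x where x:
    "\<forall>v\<in>pverts G. x v \<in> W v \<and> x v \<in> carrier_vec t \<and> x v \<noteq> 0\<^sub>v t"
    "\<forall>u\<in>pverts G. \<forall>v\<in>pverts G. u \<noteq> v \<longrightarrow> ip (x u) (x v) = 0" by (elim exE conjE)
  have "ip (x u) (x v) = 0" if "(u, v) \<in> parcs G" for u v
  proof -
    have "u \<in> pverts G" "v \<in> pverts G" "u \<noteq> v"
      using in_arcsD1[OF that] in_arcsD2[OF that] no_loops[OF that] by auto
    then show ?thesis using x(2) by simp
  qed
  then have "\<forall>(u, v)\<in>parcs G. ip (x u) (x v) = 0" by blast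
  then show "\<exists>x. (\<forall>v\<in>pverts G. x v \<in> W v \<and> x v \<noteq> 0\<^sub>v t) \<and> (\<forall>(u, v)\<in>parcs G. ip (x u) (x v) = 0)"
    using x(1) by blast
qed

text \<open>Suppose that \<open>x v\<close> is supported on \<open>L v\<close>, and let \<open>v\<close> occupy a point where \<open>x v\<close> is nonzero. No two vertices
\<open>u\<close> and \<open>v\<close> occupy the same point: if nonadjacent they have disjoint point sets, and if adjacent the
common point is the only one at which both vectors can be nonzero, so it would contribute the single
nonzero term of \<open>ip (x u) (x v)\<close>. Hence there are at most as many vertices as points. Passing to a
\<open>k\<close>-element subset of each \<open>L v\<close> covers all smaller dimensions at once.\<close>
lemma not_subspace_choosable_of_points:
  assumes k: "\<And>v. v \<in> pverts G \<Longrightarrow> L v \<subseteq> {..<t} \<and> k \<le> card (L v)"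
    and same: "\<And>u v. u \<in> pverts G \<Longrightarrow> v \<in> pverts G \<Longrightarrow> u \<noteq> v \<Longrightarrow> (u, v) \<notin> parcs G \<Longrightarrow> L u \<inter> L v = {}"
    and adj: "\<And>u v i j. (u, v) \<in> parcs G \<Longrightarrow> i \<in> L u \<inter> L v \<Longrightarrow> j \<in> L u \<inter> L v \<Longrightarrow> i = j"
    and card: "t < card (pverts G)"
  shows "\<not> subspace_choosable ip G k"
proof
  assume choosable: "subspace_choosable ip G k"
  have "\<exists>W. is_subspace_of_dim t W k \<and> W \<subseteq> carrier_vec t \<and>
     (\<forall>x\<in>W. \<forall>i<t. i \<notin> L v \<longrightarrow> x $ i = (0::'f))" if v: "v \<in> pverts G" for v
  proof -
    obtain S where S: "S \<subseteq> L v" "card S = k"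
      using obtain_subset_with_card_n[of k "L v"] k[OF v] by blast
    then have "S \<subseteq> {..<t}" using k[OF v] by blast
    then obtain W :: "'f vec set" where "is_subspace_of_dim t W (card S)" "W \<subseteq> carrier_vec t"
      "\<And>x i. x \<in> W \<Longrightarrow> i < t \<Longrightarrow> i \<notin> S \<Longrightarrow> x $ i = 0" using coordinate_subspace by blast
    then show ?thesis using S by (intro exI[of _ W]) blast
  qed
  then have "\<forall>v\<in>pverts G. \<exists>W. is_subspace_of_dim t W k \<and> W \<subseteq> carrier_vec t \<and>
     (\<forall>x\<in>W. \<forall>i<t. i \<notin> L v \<longrightarrow> x $ i = (0::'f))" by blast
  then obtain W where "\<forall>v\<in>pverts G. is_subspace_of_dim t (W v) k \<and> W v \<subseteq> carrier_vec t \<and>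
     (\<forall>x\<in>W v. \<forall>i<t. i \<notin> L v \<longrightarrow> x $ i = (0::'f))" by (rule bchoice[THEN exE])
  then have W: "\<And>v. v \<in> pverts G \<Longrightarrow> is_subspace_of_dim t (W v) k"
    "\<And>v. v \<in> pverts G \<Longrightarrow> W v \<subseteq> carrier_vec t"
    "\<And>v x i. v \<in> pverts G \<Longrightarrow> x \<in> W v \<Longrightarrow> i < t \<Longrightarrow> i \<notin> L v \<Longrightarrow> x $ i = 0" by simp_all
  have "\<forall>v\<in>pverts G. is_subspace_of_dim t (W v) k" using W(1) by simp
  then have "\<exists>x. (\<forall>v\<in>pverts G. x v \<in> W v \<and> x v \<noteq> 0\<^sub>v t) \<and> (\<forall>(u, v)\<in>parcs G. ip (x u) (x v) = 0)"
    using choosable unfolding subspace_choosable_def by simp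
  then obtain x where x': "\<forall>v\<in>pverts G. x v \<in> W v \<and> x v \<noteq> 0\<^sub>v t"
    "\<forall>(u, v)\<in>parcs G. ip (x u) (x v) = 0" by (elim exE conjE)
  have x: "\<And>v. v \<in> pverts G \<Longrightarrow> x v \<in> W v \<and> x v \<noteq> 0\<^sub>v t"
    "\<And>u v. (u, v) \<in> parcs G \<Longrightarrow> ip (x u) (x v) = 0"
    using x' by auto
  have xc: "x v \<in> carrier_vec t" if "v \<in> pverts G" for v using W(2) x(1) that by blast
  have "\<exists>i<t. x v $ i \<noteq> 0" if "v \<in> pverts G" for v
  proof (rule ccontr)
    assume "\<not> (\<exists>i<t. x v $ i \<noteq> 0)"
    then have "x v = 0\<^sub>v t" using xc[OF that] by (intro eq_vecI) auto
    then show False using x(1) that by blast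
  qed
  then obtain pt where pt: "\<And>v. v \<in> pverts G \<Longrightarrow> pt v < t" "\<And>v. v \<in> pverts G \<Longrightarrow> x v $ pt v \<noteq> 0" by metis
  have ptL: "pt v \<in> L v" if "v \<in> pverts G" for v using W(3)[OF that] pt[OF that] x(1)[OF that] by blast
  have "inj_on pt (pverts G)"
  proof (rule inj_onI, rule ccontr)
    fix u v assume uv: "u \<in> pverts G" "v \<in> pverts G" "pt u = pt v" "u \<noteq> v"
    then have both: "pt v \<in> L u \<inter> L v" using ptL[OF uv(1)] ptL[OF uv(2)] by simp
    then have arc: "(u, v) \<in> parcs G" using same[OF uv(1,2,4)] by blast
    have "ip (x u) (x v) = (\<Sum>i<t. x u $ i * \<sigma> (x v $ i))" using ip xc uv by simp
    also have "\<dots> = (\<Sum>i\<in>{pt v}. x u $ i * \<sigma> (x v $ i))"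
    proof (rule sum.mono_neutral_right)
      show "\<forall>i\<in>{..<t} - {pt v}. x u $ i * \<sigma> (x v $ i) = 0"
      proof
        fix i assume i: "i \<in> {..<t} - {pt v}"
        then have "i \<notin> L u \<or> i \<notin> L v" using adj[OF arc, of i "pt v"] both by blast
        then have "x u $ i = 0 \<or> x v $ i = 0" using W(3) x(1) uv(1,2) i by blast
        then show "x u $ i * \<sigma> (x v $ i) = 0" using \<sigma>_zero by auto
      qed
    qed (use pt(1) uv in auto)
    finally have "x u $ pt u * \<sigma> (x v $ pt v) = 0" using x(2)[OF arc] uv(3) by simp
    moreover have "x u $ pt u \<noteq> 0" using pt(2)[OF uv(1)] .
    ultimately have "\<sigma> (x v $ pt v) = 0" by simp
    then have "x v $ pt v = 0" using \<sigma>_invol[of "x v $ pt v"] \<sigma>_zero by simp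
    then show False using pt(2) uv by blast
  qed
  moreover have "pt ` pverts G \<subseteq> {..<t}" using pt(1) by auto
  ultimately have "card (pverts G) \<le> t" using card_inj_on_le[of pt "pverts G" "{..<t}"] by simp
  then show False using card by simp
qed

end

text \<open>The graph keeps at least \<open>q (q + 1) - (q - 1) = q\<^sup>2 + 1\<close> vertices, one more than the plane has points.\<close>
lemma (in sesquilinear_dot) ch_s_gt:
  assumes q: "primepow q"
    and P: "disjoint P" "card P = q + 1" "\<forall>A\<in>P. card A = q"
    and R: "R \<subseteq> \<Union>P" "card R \<le> q - 1"
  shows "q < ch_s ip (remove_verts (complete_multipartite P) R)"
proof -
  let ?G = "remove_verts (complete_multipartite P) R"
  have q1: "q > 1" using primepow_gt_Suc_0[OF q] by simp
  have finP: "finite P" using P(2) card_ge_0_finite[of P] by simp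
  have fin: "finite A" if "A \<in> P" for A using card_ge_0_finite[of A] P(3) that q1 by auto
  have pair: "pair_graph ?G"
    using finP fin P(1) by (intro pair_graph_remove_verts pair_graph_complete_multipartite) auto
  have verts: "pverts ?G = \<Union>P - R" by (simp add: remove_verts_def complete_multipartite_def)
  have arcs: "parcs ?G = {(u, v). \<exists>A\<in>P. \<exists>B\<in>P. A \<noteq> B \<and> u \<in> A \<and> v \<in> B \<and> u \<notin> R \<and> v \<notin> R}"
    by (auto simp: remove_verts_def complete_multipartite_def)
  have "card (\<Union>P) = (\<Sum>A\<in>P. card A)"
    using P(1) fin by (intro card_Union_disjoint) (auto simp: disjoint_def pairwise_def disjnt_def)
  also have "\<dots> = (q + 1) * q" using P(2,3) by simp
  finally have "card (\<Union>P) = (q + 1) * q" .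
  moreover have "finite R" using R(1) finP fin finite_subset by blast
  ultimately have "card (pverts ?G) = (q + 1) * q - card R"
    unfolding verts using R(1) by (simp add: card_Diff_subset)
  then have many: "q * q < card (pverts ?G)" using R(2) q1 by simp
  obtain L :: "'a \<Rightarrow> nat set" where
    L: "\<And>v. v \<in> \<Union>P \<Longrightarrow> L v \<subseteq> {..<q * q} \<and> card (L v) = q"
    and L_parallel: "\<And>A u v. A \<in> P \<Longrightarrow> u \<in> A \<Longrightarrow> v \<in> A \<Longrightarrow> u \<noteq> v \<Longrightarrow> L u \<inter> L v = {}"
    and L_meet: "\<And>A B u v i j. A \<in> P \<Longrightarrow> B \<in> P \<Longrightarrow> A \<noteq> B \<Longrightarrow> u \<in> A \<Longrightarrow> v \<in> B \<Longrightarrow>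
       i \<in> L u \<inter> L v \<Longrightarrow> j \<in> L u \<inter> L v \<Longrightarrow> i = j"
    using affine_plane_lines[OF q P] by blast
  have not_choosable: "\<not> subspace_choosable ip ?G k" if "k \<le> q" for k
  proof (rule not_subspace_choosable_of_points[where L = L and t = "q * q"])
    show "L v \<subseteq> {..<q * q} \<and> k \<le> card (L v)" if "v \<in> pverts ?G" for v
      using L that \<open>k \<le> q\<close> by (auto simp: verts)
    show "L u \<inter> L v = {}"
      if "u \<in> pverts ?G" "v \<in> pverts ?G" "u \<noteq> v" "(u, v) \<notin> parcs ?G" for u v
    proof -
      obtain A B where AB: "A \<in> P" "B \<in> P" "u \<in> A" "v \<in> B" "u \<notin> R" "v \<notin> R"
        using \<open>u \<in> pverts ?G\<close> \<open>v \<in> pverts ?G\<close> unfolding verts by blast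
      then have "A = B" using \<open>(u, v) \<notin> parcs ?G\<close> unfolding arcs by blast
      then show ?thesis using L_parallel[of A u v] AB \<open>u \<noteq> v\<close> by simp
    qed
    show "i = j" if "(u, v) \<in> parcs ?G" "i \<in> L u \<inter> L v" "j \<in> L u \<inter> L v" for u v i j
    proof -
      obtain A B where "A \<in> P" "B \<in> P" "A \<noteq> B" "u \<in> A" "v \<in> B"
        using \<open>(u, v) \<in> parcs ?G\<close> unfolding arcs by blast
      then show ?thesis using L_meet[of A B u v i j] that(2,3) by simp
    qed
    show "q * q < card (pverts ?G)" by (rule many)
  qed
  have "0 < Suc (card (pverts ?G)) \<and> subspace_choosable ip ?G (Suc (card (pverts ?G)))"
    using subspace_choosable_Suc_card[OF pair] by simp
  then have "0 < ch_s ip ?G \<and> subspace_choosable ip ?G (ch_s ip ?G)"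
    unfolding ch_s_def by (rule LeastI)
  then show ?thesis using not_choosable not_le by blast
qed

theorem theorem2p7:
  fixes q :: nat and P :: "'v set set" and R :: "'v set"
    and H G :: "'v pair_pre_digraph"
  assumes "primepow q"
    and "disjoint P" "card P = q + 1" "\<forall>A\<in>P. card A = q"
    and "H = complete_multipartite P"
    and "R \<subseteq> pverts H" "card R \<le> q - 1"
    and "G = remove_verts H R"
  shows "q < ch_s (scalar_prod :: 'f::field vec \<Rightarrow> 'f vec \<Rightarrow> 'f) G \<and>
         q < ch_s (cscalar_prod :: complex vec \<Rightarrow> complex vec \<Rightarrow> complex) G"
proof -
  have R: "R \<subseteq> \<Union>P" using assms(5,6) by (simp add: complete_multipartite_def)
  interpret bilinear: sesquilinear_dot "scalar_prod :: 'f vec \<Rightarrow> 'f vec \<Rightarrow> 'f" "\<lambda>a. a"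
    by unfold_locales (simp_all add: scalar_prod_def atLeast0LessThan)
  interpret hermitian: sesquilinear_dot "cscalar_prod :: complex vec \<Rightarrow> complex vec \<Rightarrow> complex" cnj
    by unfold_locales (simp_all add: scalar_prod_def atLeast0LessThan)
  show ?thesis
    unfolding assms(5,8)
    using bilinear.ch_s_gt[OF assms(1-4) R assms(7)] hermitian.ch_s_gt[OF assms(1-4) R assms(7)] by blast
qed

end
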